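(* Let $A\in\mathbb{R}^{m\times n}$ and $1\le k<\min(m,n)$. Let $\widehat V_k\in\mathbb{R}^{m\times k}$, $\widehat S_k\in\mathbb{R}^{k\times k}$, $\widehat W_k\in\mathbb{R}^{n\times k}$ satisfy $$\|A-\widehat V_k\widehat S_k\widehat W_k^T\|\le \theta\,\sigma_{k+1}+\phi$$ for some real quantities $\theta,\phi$. Suppose the DEIM index vectors $p=\mathrm{DEIM}(\widehat V_k)$ and $q=\mathrm{DEIM}(\widehat W_k)$ are computed from $\widehat V_k$ and $\widehat W_k$, let $P=I(:,p)\in\mathbb{R}^{m\times k}$ and $Q=I(:,q)\in\mathbb{R}^{n\times k}$, and assume that $P^T\widehat V_k$ and $\widehat W_k^TQ$ are invertible. Set $\tilde\eta_p=\|(P^T\widehat V_k)^{-1}\|$ and $\tilde\eta_q=\|(\widehat W_k^TQ)^{-1}\|$. Let $C=AQ$, $R=P^TA$, and $U=C^\dagger AR^\dagger$. Then $$\|A-CUR\|\le \bigl(\|\widehat W_k\|\,\tilde\eta_q+\|\widehat V_k\|\,\tilde\eta_p\bigr)\bigl(\theta\,\sigma_{k+1}+\phi\bigr).$$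
   Context: $\|\cdot\|$ denotes the matrix 2-norm (spectral norm). $\sigma_{k+1}$ is the $(k+1)$-th singular value of $A$ in descending order. $\dagger$ denotes the Moore–Penrose pseudoinverse. The columns of $\widehat V_k$ and $\widehat W_k$ are not assumed orthonormal and $\widehat S_k$ need not contain exact singular values of $A$. $I(:,p)$ (resp. $I(:,q)$) is the matrix whose $j$-th column is the $p_j$-th (resp. $q_j$-th) column of the identity matrix of size $m$ (resp. $n$). DEIM point selection: given a matrix $V=[v_1,\dots,v_k]\in\mathbb{R}^{m\times k}$ with $m\ge k$, $\mathrm{DEIM}(V)$ returns $p=(p_1,\dots,p_k)$ defined as follows. $p_1$ is an index at which $|v_1|$ attains its maximal entry. For $j=2,\dots,k$, with $\mathbf p=(p_1,\dots,p_{j-1})$, let $c=V(\mathbf p,1\!:\!j-1)^{-1}v_j(\mathbf p)$ and $r=v_j-V(:,1\!:\!j-1)c$, and let $p_j$ be an index at which $|r|$ attains its maximal entry. Here $V(\mathbf p,1\!:\!j-1)$ is the submatrix with rows $\mathbf p$ and the first $j-1$ columns, $v_j(\mathbf p)$ the subvector with entries $\mathbf p$, and absolute values of vectors are entrywise. *)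

theory Defs
  imports
    "Jordan_Normal_Form.Gauss_Jordan_Elimination"
    "Jordan_Normal_Form.Char_Poly"
begin

definition spectral_norm :: "real mat \<Rightarrow> real" where
  "spectral_norm M =
     Sup {sqrt ((M *\<^sub>v x) \<bullet> (M *\<^sub>v x)) | x. x \<in> carrier_vec (dim_col M) \<and> sqrt (x \<bullet> x) \<le> 1}"

(* The min(m,n) singular values of an m x n matrix in descending order, with multiplicity: square
   roots of the largest min(m,n) eigenvalues of the n x n Gram matrix, which is positive
   semidefinite, so that proots yields all n eigenvalues. The list is 0-indexed: the (k+1)-th
   singular value is  singular_values M ! k. *)
definition singular_values :: "real mat \<Rightarrow> real list" where
  "singular_values M =
     take (min (dim_row M) (dim_col M))
       (rev (sorted_list_of_multiset (image_mset sqrt (proots (char_poly (M\<^sup>T * M))))))"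

definition is_pseudoinverse :: "real mat \<Rightarrow> real mat \<Rightarrow> bool" where
  "is_pseudoinverse M X \<longleftrightarrow>
     X \<in> carrier_mat (dim_col M) (dim_row M) \<and>
     M * X * M = M \<and> X * M * X = X \<and> (M * X)\<^sup>T = M * X \<and> (X * M)\<^sup>T = X * M"

definition pseudoinverse :: "real mat \<Rightarrow> real mat" where
  "pseudoinverse M = (THE X. is_pseudoinverse M X)"

(* mat_inverse returns an option: None exactly for non-invertible arguments. This total version
   is only meaningful for invertible matrices. *)
definition mat_inv :: "real mat \<Rightarrow> real mat" where
  "mat_inv M = the (mat_inverse M)"

definition attains_max_abs_at :: "real vec \<Rightarrow> nat \<Rightarrow> bool" where
  "attains_max_abs_at v i \<longleftrightarrow> i < dim_vec v \<and> (\<forall>i'<dim_vec v. \<bar>v $ i'\<bar> \<le> \<bar>v $ i\<bar>)"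

(* DEIM V p: p is a possible output of the DEIM selection applied to V (ties in the maximum may be
   broken arbitrarily). Indices are 0-based, so step j uses the j previously chosen rows
   p ! 0, ..., p ! (j-1) and the first j columns of V. Each step requires the inverse it uses to
   exist. *)
definition DEIM :: "real mat \<Rightarrow> nat list \<Rightarrow> bool" where
  "DEIM V p \<longleftrightarrow>
     length p = dim_col V \<and>
     (0 < dim_col V \<longrightarrow> attains_max_abs_at (col V 0) (p ! 0)) \<and>
     (\<forall>j. 1 \<le> j \<and> j < dim_col V \<longrightarrow>
        (let Vp = mat j j (\<lambda>(a, b). V $$ (p ! a, b));
             vp = vec j (\<lambda>a. V $$ (p ! a, j));
             Vj = mat (dim_row V) j (\<lambda>(a, b). V $$ (a, b));
             c = mat_inv Vp *\<^sub>v vp;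
             r = col V j - Vj *\<^sub>v c
         in invertible_mat Vp \<and> attains_max_abs_at r (p ! j)))"

(* The matrix I(:,p) for the identity matrix I of size m. *)
definition selection_mat :: "nat \<Rightarrow> nat list \<Rightarrow> real mat" where
  "selection_mat m p = mat_of_cols m (map (col (1\<^sub>m m)) p)"

end

theory Submission
  imports Defs "HOL-Analysis.L2_Norm"
begin

text \<open>
  Put \<open>E = A - V * S * W\<^sup>T\<close>, and let \<open>C * X\<close> and \<open>Y * R\<close>, for the pseudoinverses \<open>X\<close> of \<open>C\<close> and
  \<open>Y\<close> of \<open>R\<close>, be the orthogonal projections onto the column space of \<open>C\<close> and the row space of
  \<open>R\<close>. Then
  \<open>A - C * U * R = (1 - C * X) * A + C * X * (A * (1 - Y * R))\<close>, and since \<open>C * X\<close> has norm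
  at most 1, it suffices to bound \<open>(1 - C * X) * A\<close> and \<open>A * (1 - Y * R)\<close> separately. The second
  becomes the first when everything is transposed.

  For the first, write \<open>G\<close> for the inverse of \<open>W\<^sup>T * Q\<close> and consider the oblique interpolatory
  projection \<open>H = Q * G * W\<^sup>T\<close>. As \<open>1 - C * X\<close> kills \<open>C = A * Q\<close>, hence \<open>A * H\<close>, it takes the same
  value on \<open>A\<close> as on \<open>A * (1 - H)\<close>. As \<open>W\<^sup>T * (1 - H) = 0\<close>, the low-rank term drops out
  and \<open>A * (1 - H) = E * (1 - H)\<close>. So the error is at most
  \<open>spectral_norm E * spectral_norm (1 - H)\<close>, and the complement of a nonzero projection has norm
  at most that of the projection itself (\<open>spectral_norm_complement_projection_le\<close>), which for \<open>H\<close>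
  is at most \<open>spectral_norm G * spectral_norm W\<close> because \<open>Q\<close> has orthonormal columns. This is
  \<open>column_projection_error\<close>.

  The DEIM selection places the indices in range, and the invertibility of \<open>W\<^sup>T * Q\<close> makes them
  distinct; together this makes the columns of \<open>Q\<close> orthonormal.

  The pseudoinverse is a definite description, so its defining equations become available only
  through existence and uniqueness (\<open>pseudoinverse_exists\<close>, \<open>pseudoinverse_unique\<close>). Existence
  for a matrix of arbitrary rank rests on the solvability of the normal equations
  (\<open>least_squares_solution\<close>), obtained by adding one column at a time as in Gram--Schmidt.
\<close>

section \<open>The Euclidean norm and the spectral norm\<close>

definition euclid_norm :: "real vec \<Rightarrow> real" where
  "euclid_norm x = sqrt (x \<bullet> x)"

lemma euclid_norm_L2_set: "euclid_norm x = L2_set (($) x) {0..<dim_vec x}"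
  by (simp add: euclid_norm_def L2_set_def scalar_prod_def power2_eq_square)

lemma euclid_norm_ge_0: "0 \<le> euclid_norm x"
  by (simp add: euclid_norm_L2_set)

lemma euclid_norm_square: "(euclid_norm x)\<^sup>2 = x \<bullet> x"
  by (simp add: euclid_norm_def scalar_prod_def sum_nonneg)

lemma euclid_norm_eq_0: "x \<in> carrier_vec n \<Longrightarrow> euclid_norm x = 0 \<longleftrightarrow> x = 0\<^sub>v n"
  by (auto simp: euclid_norm_L2_set L2_set_eq_0_iff)

lemma euclid_norm_smult: "euclid_norm (a \<cdot>\<^sub>v x) = \<bar>a\<bar> * euclid_norm x"
  by (simp add: euclid_norm_def real_sqrt_mult flip: mult.assoc)

lemma euclid_norm_triangle:
  assumes "x \<in> carrier_vec n" "y \<in> carrier_vec n"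
  shows "euclid_norm (x + y) \<le> euclid_norm x + euclid_norm y"
proof -
  have "euclid_norm (x + y) = L2_set (\<lambda>i. x $ i + y $ i) {0..<n}"
    unfolding euclid_norm_L2_set using assms by (intro L2_set_cong) auto
  also have "\<dots> \<le> L2_set (($) x) {0..<n} + L2_set (($) y) {0..<n}"
    by (rule L2_set_triangle_ineq)
  finally show ?thesis using assms by (simp add: euclid_norm_L2_set)
qed

lemma scalar_prod_le_euclid_norm:
  assumes "x \<in> carrier_vec n" "y \<in> carrier_vec n"
  shows "\<bar>x \<bullet> y\<bar> \<le> euclid_norm x * euclid_norm y"
proof -
  have "\<bar>x \<bullet> y\<bar> \<le> (\<Sum>i\<in>{0..<n}. \<bar>x $ i\<bar> * \<bar>y $ i\<bar>)"
    using assms sum_abs[of "\<lambda>i. x $ i * y $ i" "{0..<n}"] by (simp add: scalar_prod_def abs_mult)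
  also have "\<dots> \<le> euclid_norm x * euclid_norm y"
    using L2_set_mult_ineq[of "($) x" "($) y" "{0..<n}"] assms by (simp add: euclid_norm_L2_set)
  finally show ?thesis .
qed

text \<open>This bounds the set whose supremum is the spectral norm; a real supremum of an unbounded set
  would carry no information.\<close>

lemma mult_mat_vec_bounded:
  fixes M :: "real mat"
  obtains K where "0 \<le> K"
    "\<And>x. x \<in> carrier_vec (dim_col M) \<Longrightarrow> euclid_norm (M *\<^sub>v x) \<le> K * euclid_norm x"
proof
  let ?K = "\<Sum>i\<in>{0..<dim_row M}. euclid_norm (row M i)"
  show "0 \<le> ?K" by (simp add: sum_nonneg euclid_norm_ge_0)
  fix x :: "real vec" assume x: "x \<in> carrier_vec (dim_col M)"
  have "euclid_norm (M *\<^sub>v x) \<le> (\<Sum>i\<in>{0..<dim_row M}. \<bar>(M *\<^sub>v x) $ i\<bar>)"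
    unfolding euclid_norm_L2_set by (rule order_trans[OF L2_set_le_sum_abs]) simp
  also have "\<dots> \<le> (\<Sum>i\<in>{0..<dim_row M}. euclid_norm (row M i) * euclid_norm x)"
    using x by (intro sum_mono) (simp add: scalar_prod_le_euclid_norm[of _ "dim_col M"])
  finally show "euclid_norm (M *\<^sub>v x) \<le> ?K * euclid_norm x"
    by (simp add: sum_distrib_right)
qed

lemma spectral_norm_euclid_norm:
  "spectral_norm M =
     Sup {euclid_norm (M *\<^sub>v x) | x. x \<in> carrier_vec (dim_col M) \<and> euclid_norm x \<le> 1}"
  by (simp add: spectral_norm_def euclid_norm_def)

lemma zero_in_unit_ball: "0\<^sub>v n \<in> carrier_vec n \<and> euclid_norm (0\<^sub>v n) \<le> 1"
  by (simp add: euclid_norm_def)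

lemma euclid_norm_le_spectral_norm_unit:
  assumes "x \<in> carrier_vec (dim_col M)" "euclid_norm x \<le> 1"
  shows "euclid_norm (M *\<^sub>v x) \<le> spectral_norm M"
  unfolding spectral_norm_euclid_norm
proof (rule cSup_upper)
  obtain K where K: "0 \<le> K"
    "\<And>x. x \<in> carrier_vec (dim_col M) \<Longrightarrow> euclid_norm (M *\<^sub>v x) \<le> K * euclid_norm x"
    using mult_mat_vec_bounded[of M] by blast
  show "bdd_above {euclid_norm (M *\<^sub>v x) | x. x \<in> carrier_vec (dim_col M) \<and> euclid_norm x \<le> 1}"
  proof (rule bdd_aboveI[of _ K], clarify)
    fix x assume "x \<in> carrier_vec (dim_col M)" "euclid_norm x \<le> 1"
    then show "euclid_norm (M *\<^sub>v x) \<le> K"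
      using K(1) K(2)[of x] mult_left_le[of "euclid_norm x" K] by linarith
  qed
qed (use assms in auto)

lemma spectral_norm_ge_0: "0 \<le> spectral_norm M"
  using euclid_norm_le_spectral_norm_unit[of "0\<^sub>v (dim_col M)" M] zero_in_unit_ball
    euclid_norm_ge_0 order_trans by blast

lemma euclid_norm_mult_mat_vec_le:
  assumes "M \<in> carrier_mat m n" "x \<in> carrier_vec n"
  shows "euclid_norm (M *\<^sub>v x) \<le> spectral_norm M * euclid_norm x"
proof (cases "euclid_norm x = 0")
  case True
  obtain K where "euclid_norm (M *\<^sub>v x) \<le> K * euclid_norm x"
    using mult_mat_vec_bounded[of M] assms by (metis carrier_matD(2))
  then show ?thesis using True by simp
next
  case False
  let ?c = "euclid_norm x"
  have c: "0 < ?c" using False euclid_norm_ge_0[of x] by linarith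
  have "euclid_norm (M *\<^sub>v (inverse ?c \<cdot>\<^sub>v x)) \<le> spectral_norm M"
    using assms c by (intro euclid_norm_le_spectral_norm_unit) (auto simp: euclid_norm_smult)
  then show ?thesis
    using assms c by (simp add: mult_mat_vec[OF assms] euclid_norm_smult field_simps)
qed

lemma spectral_norm_leI:
  assumes "M \<in> carrier_mat m n" "0 \<le> K"
    and "\<And>x. x \<in> carrier_vec n \<Longrightarrow> euclid_norm (M *\<^sub>v x) \<le> K * euclid_norm x"
  shows "spectral_norm M \<le> K"
  unfolding spectral_norm_euclid_norm
proof (rule cSup_least)
  show "{euclid_norm (M *\<^sub>v x) | x. x \<in> carrier_vec (dim_col M) \<and> euclid_norm x \<le> 1} \<noteq> {}"
    using zero_in_unit_ball by blast
  fix y assume "y \<in> {euclid_norm (M *\<^sub>v x) | x. x \<in> carrier_vec (dim_col M) \<and> euclid_norm x \<le> 1}"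
  then obtain x where "y = euclid_norm (M *\<^sub>v x)" "x \<in> carrier_vec n" "euclid_norm x \<le> 1"
    using assms(1) by auto
  then show "y \<le> K" using assms(3)[of x] mult_left_le[OF _ assms(2)] by fastforce
qed

lemma spectral_norm_mult_le:
  assumes A: "A \<in> carrier_mat m n" and B: "B \<in> carrier_mat n l"
  shows "spectral_norm (A * B) \<le> spectral_norm A * spectral_norm B"
proof (rule spectral_norm_leI)
  show "A * B \<in> carrier_mat m l" using assms by simp
  show "0 \<le> spectral_norm A * spectral_norm B" by (simp add: spectral_norm_ge_0)
  fix x :: "real vec" assume x: "x \<in> carrier_vec l"
  have "euclid_norm (A *\<^sub>v (B *\<^sub>v x)) \<le> spectral_norm A * euclid_norm (B *\<^sub>v x)"
    using assms x by (intro euclid_norm_mult_mat_vec_le) auto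
  also have "\<dots> \<le> spectral_norm A * (spectral_norm B * euclid_norm x)"
    using B x by (intro mult_left_mono euclid_norm_mult_mat_vec_le spectral_norm_ge_0)
  finally show "euclid_norm (A * B *\<^sub>v x) \<le> spectral_norm A * spectral_norm B * euclid_norm x"
    using assms x by (simp add: mult.assoc)
qed

lemma spectral_norm_triangle:
  assumes "A \<in> carrier_mat m n" "B \<in> carrier_mat m n"
  shows "spectral_norm (A + B) \<le> spectral_norm A + spectral_norm B"
proof (rule spectral_norm_leI)
  show "A + B \<in> carrier_mat m n" using assms by simp
  show "0 \<le> spectral_norm A + spectral_norm B" by (simp add: spectral_norm_ge_0)
  fix x :: "real vec" assume x: "x \<in> carrier_vec n"
  have "euclid_norm (A *\<^sub>v x + B *\<^sub>v x) \<le> euclid_norm (A *\<^sub>v x) + euclid_norm (B *\<^sub>v x)"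
    using assms x by (intro euclid_norm_triangle[of _ m]) auto
  also have "\<dots> \<le> spectral_norm A * euclid_norm x + spectral_norm B * euclid_norm x"
    using assms x by (intro add_mono euclid_norm_mult_mat_vec_le) auto
  finally show "euclid_norm ((A + B) *\<^sub>v x) \<le> (spectral_norm A + spectral_norm B) * euclid_norm x"
    using assms x by (simp add: add_mult_distrib_mat_vec[OF assms x] distrib_right)
qed

lemma scalar_prod_transpose:
  assumes "M \<in> carrier_mat m n" "(x :: real vec) \<in> carrier_vec n" "y \<in> carrier_vec m"
  shows "(M *\<^sub>v x) \<bullet> y = x \<bullet> (M\<^sup>T *\<^sub>v y)"
  using transpose_vec_mult_scalar[OF assms] assms
  by (metis comm_scalar_prod mult_mat_vec_carrier transpose_carrier_mat)

text \<open>Moving one factor of \<open>(M x) \<bullet> (M x)\<close> to the other side bounds \<open>M x\<close> through \<open>M\<^sup>T M x\<close>;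
  this one estimate yields the norm of a transpose and of an orthogonal projection.\<close>

lemma euclid_norm_le_via_Gram:
  assumes M: "M \<in> carrier_mat m n" and x: "x \<in> carrier_vec n"
    and le: "euclid_norm (M\<^sup>T *\<^sub>v (M *\<^sub>v x)) \<le> K * euclid_norm (M *\<^sub>v x)"
    and K: "0 \<le> K"
  shows "euclid_norm (M *\<^sub>v x) \<le> K * euclid_norm x"
proof (cases "euclid_norm (M *\<^sub>v x) = 0")
  case True
  then show ?thesis using K euclid_norm_ge_0[of x] by simp
next
  case False
  have "(euclid_norm (M *\<^sub>v x))\<^sup>2 = x \<bullet> (M\<^sup>T *\<^sub>v (M *\<^sub>v x))"
    using M x by (simp add: euclid_norm_square scalar_prod_transpose[OF M x])
  also have "\<dots> \<le> euclid_norm x * euclid_norm (M\<^sup>T *\<^sub>v (M *\<^sub>v x))"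
    using scalar_prod_le_euclid_norm[of x n "M\<^sup>T *\<^sub>v (M *\<^sub>v x)"] M x by simp
  also have "\<dots> \<le> euclid_norm x * (K * euclid_norm (M *\<^sub>v x))"
    by (intro mult_left_mono le euclid_norm_ge_0)
  finally have "euclid_norm (M *\<^sub>v x) * euclid_norm (M *\<^sub>v x)
      \<le> (K * euclid_norm x) * euclid_norm (M *\<^sub>v x)"
    by (simp add: power2_eq_square algebra_simps)
  then show ?thesis
    using False euclid_norm_ge_0[of "M *\<^sub>v x"] by (simp add: mult_le_cancel_right)
qed

lemma spectral_norm_transpose_le:
  assumes M: "M \<in> carrier_mat m n"
  shows "spectral_norm (M\<^sup>T) \<le> spectral_norm M"
proof (rule spectral_norm_leI)
  show Mt: "M\<^sup>T \<in> carrier_mat n m" using M by simp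
  fix y :: "real vec" assume y: "y \<in> carrier_vec m"
  show "euclid_norm (M\<^sup>T *\<^sub>v y) \<le> spectral_norm M * euclid_norm y"
    using M Mt y spectral_norm_ge_0 by (intro euclid_norm_le_via_Gram[OF Mt])
      (auto intro!: euclid_norm_mult_mat_vec_le)
qed (rule spectral_norm_ge_0)

lemma spectral_norm_transpose: "spectral_norm (M\<^sup>T) = spectral_norm M"
  using spectral_norm_transpose_le[of M "dim_row M" "dim_col M"]
    spectral_norm_transpose_le[of "M\<^sup>T" "dim_col M" "dim_row M"] by simp

lemma spectral_norm_orthonormal_columns_le:
  assumes Q: "Q \<in> carrier_mat n k" and orth: "Q\<^sup>T * Q = 1\<^sub>m k"
  shows "spectral_norm Q \<le> 1"
proof (rule spectral_norm_leI[OF Q])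
  fix x :: "real vec" assume x: "x \<in> carrier_vec k"
  have "Q\<^sup>T *\<^sub>v (Q *\<^sub>v x) = x"
    using Q x orth assoc_mult_mat_vec[of "Q\<^sup>T" k n Q k x] by simp
  then have "(Q *\<^sub>v x) \<bullet> (Q *\<^sub>v x) = x \<bullet> x"
    using scalar_prod_transpose[OF Q x, of "Q *\<^sub>v x"] Q x by simp
  then show "euclid_norm (Q *\<^sub>v x) \<le> 1 * euclid_norm x"
    by (simp add: euclid_norm_def)
qed simp

section \<open>Projections\<close>

lemma spectral_norm_orthogonal_projection_le:
  assumes H: "H \<in> carrier_mat n n" and sym: "H\<^sup>T = H" and idem: "H * H = H"
  shows "spectral_norm H \<le> 1"
proof (rule spectral_norm_leI[OF H])
  fix x :: "real vec" assume x: "x \<in> carrier_vec n"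
  have "H *\<^sub>v (H *\<^sub>v x) = H *\<^sub>v x"
    using assoc_mult_mat_vec[OF H H x] idem by simp
  then show "euclid_norm (H *\<^sub>v x) \<le> 1 * euclid_norm x"
    by (intro euclid_norm_le_via_Gram[OF H x]) (simp_all add: sym)
qed simp

lemma complement_projection:
  assumes H: "(H :: real mat) \<in> carrier_mat n n" and idem: "H * H = H"
  shows "(1\<^sub>m n - H) * (1\<^sub>m n - H) = 1\<^sub>m n - H"
proof -
  have "H * (1\<^sub>m n - H) = 0\<^sub>m n n"
    using H idem by (simp add: mult_minus_distrib_mat[OF H _ H])
  moreover have "(1\<^sub>m n - H) * (1\<^sub>m n - H) = (1\<^sub>m n - H) - H * (1\<^sub>m n - H)"
    using minus_mult_distrib_mat[OF one_carrier_mat H minus_carrier_mat[OF H]]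
      left_mult_one_mat[OF minus_carrier_mat[OF H]] by metis
  moreover have "1\<^sub>m n - H - 0\<^sub>m n n = 1\<^sub>m n - H" using H by auto
  ultimately show ?thesis by simp
qed

text \<open>A nonzero oblique projection is at least as large as its complement. Split
  \<open>x = u + v\<close> with \<open>u\<close> in the range and \<open>v\<close> in the kernel of \<open>H\<close>. Exchanging the
  lengths of \<open>u\<close> and \<open>v\<close> while keeping their directions gives a vector of the same norm as \<open>x\<close>
  whose image under \<open>H\<close> has norm \<open>euclid_norm v\<close>.\<close>

lemma spectral_norm_complement_projection_le:
  assumes H: "H \<in> carrier_mat n n" and idem: "H * H = H" and nz: "H \<noteq> 0\<^sub>m n n"
  shows "spectral_norm (1\<^sub>m n - H) \<le> spectral_norm H"
proof (rule spectral_norm_leI)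
  show cH: "1\<^sub>m n - H \<in> carrier_mat n n" by (rule minus_carrier_mat[OF H])
  show "0 \<le> spectral_norm H" by (rule spectral_norm_ge_0)
  fix x :: "real vec" assume x: "x \<in> carrier_vec n"
  define u where "u = H *\<^sub>v x"
  define v where "v = (1\<^sub>m n - H) *\<^sub>v x"
  have u: "u \<in> carrier_vec n" and v: "v \<in> carrier_vec n"
    unfolding u_def v_def using H cH x by (auto intro: mult_mat_vec_carrier)
  have v': "v = x - u"
    using H x by (simp add: v_def u_def minus_mult_distrib_mat_vec[of _ n n])
  have xuv: "x = u + v" using x u by (auto simp: v')
  have Hu: "H *\<^sub>v u = u"
    using assoc_mult_mat_vec[OF H H x] idem by (simp add: u_def)
  have Hv: "H *\<^sub>v v = 0\<^sub>v n"
    using H x u Hu by (simp add: v' mult_minus_distrib_mat_vec[OF H] u_def[symmetric])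
  have "euclid_norm v \<le> spectral_norm H * euclid_norm x"
  proof (cases "u = 0\<^sub>v n")
    case True
    have "1 \<le> spectral_norm H"
    proof -
      obtain j where j: "j < n" "col H j \<noteq> 0\<^sub>v n"
        using nz H by (metis (mono_tags, lifting) carrier_matD eq_matI index_col index_zero_mat(1-3)
            index_zero_vec(1))
      let ?h = "col H j"
      have h: "?h \<in> carrier_vec n" using H by auto
      have "H *\<^sub>v ?h = ?h"
        using col_mult2[OF H H j(1)] idem by simp
      then have "euclid_norm ?h \<le> spectral_norm H * euclid_norm ?h"
        using euclid_norm_mult_mat_vec_le[OF H h] by simp
      moreover have "0 < euclid_norm ?h"
        using j(2) euclid_norm_eq_0[OF h] euclid_norm_ge_0[of ?h] by linarith
      ultimately show ?thesis by (simp add: mult_le_cancel_right1)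
    qed
    moreover have "v = x" using True x by (simp add: v')
    ultimately show ?thesis
      using mult_right_mono[OF _ euclid_norm_ge_0, of 1 "spectral_norm H" x] by simp
  next
    case un: False
    show ?thesis
    proof (cases "v = 0\<^sub>v n")
      case True
      then have "euclid_norm v = 0" using v euclid_norm_eq_0 by blast
      then show ?thesis by (simp add: spectral_norm_ge_0 euclid_norm_ge_0)
    next
      case vn: False
      define a where "a = euclid_norm v / euclid_norm u"
      define b where "b = euclid_norm u / euclid_norm v"
      have pos: "0 < euclid_norm u" "0 < euclid_norm v"
        using un vn u v euclid_norm_eq_0 euclid_norm_ge_0 by (metis less_eq_real_def)+
      define w where "w = a \<cdot>\<^sub>v u + b \<cdot>\<^sub>v v"
      have w: "w \<in> carrier_vec n" using u v by (simp add: w_def)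
      have exp: "(s \<cdot>\<^sub>v u + t \<cdot>\<^sub>v v) \<bullet> (s \<cdot>\<^sub>v u + t \<cdot>\<^sub>v v)
          = s\<^sup>2 * (u \<bullet> u) + 2 * (s * t) * (u \<bullet> v) + t\<^sup>2 * (v \<bullet> v)" for s t
        using u v comm_scalar_prod[OF u v]
        by (simp add: add_scalar_prod_distrib[of _ n] scalar_prod_add_distrib[of _ n]
            power2_eq_square algebra_simps)
      have "a * b = 1" using pos by (simp add: a_def b_def)
      moreover have "a\<^sup>2 * (u \<bullet> u) = v \<bullet> v" "b\<^sup>2 * (v \<bullet> v) = u \<bullet> u"
        using pos by (simp_all add: a_def b_def power_divide flip: euclid_norm_square)
      ultimately have "w \<bullet> w = x \<bullet> x"
        using exp[of a b] exp[of 1 1] by (simp add: w_def xuv)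
      then have "euclid_norm w = euclid_norm x" by (simp add: euclid_norm_def)
      moreover have "H *\<^sub>v w = a \<cdot>\<^sub>v u"
        using H u v Hu Hv
        by (auto simp: w_def mult_add_distrib_mat_vec[OF H] mult_mat_vec[OF H])
      moreover have "euclid_norm (a \<cdot>\<^sub>v u) = euclid_norm v"
        using pos by (simp add: euclid_norm_smult a_def)
      ultimately show ?thesis using euclid_norm_mult_mat_vec_le[OF H w] by simp
    qed
  qed
  then show "euclid_norm ((1\<^sub>m n - H) *\<^sub>v x) \<le> spectral_norm H * euclid_norm x"
    by (simp add: v_def)
qed

section \<open>The Moore--Penrose pseudoinverse\<close>

text \<open>Induction on the number of columns. With \<open>N\<close> the matrix without its last column \<open>c\<close>, let
  \<open>b'\<close> and \<open>c'\<close> be the residuals of \<open>b\<close> and \<open>c\<close> against \<open>N\<close>. Subtracting from \<open>b'\<close> its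
  component along \<open>c'\<close> leaves a residual orthogonal to \<open>N\<close> and to \<open>c'\<close>, thus also to \<open>c\<close>.\<close>

lemma least_squares_solution:
  assumes "(M :: real mat) \<in> carrier_mat m n" "b \<in> carrier_vec m"
  shows "\<exists>x \<in> carrier_vec n. M\<^sup>T *\<^sub>v (b - M *\<^sub>v x) = 0\<^sub>v n"
  using assms
proof (induction n arbitrary: M b)
  case 0
  then show ?case by (intro bexI[of _ "0\<^sub>v 0"]) auto
next
  case (Suc n)
  define N where "N = mat m n (\<lambda>(i, j). M $$ (i, j))"
  define c where "c = col M n"
  have N: "N \<in> carrier_mat m n" by (simp add: N_def)
  have c: "c \<in> carrier_vec m" using Suc.prems by (auto simp: c_def)
  have b: "b \<in> carrier_vec m" by fact
  obtain x where x: "x \<in> carrier_vec n" "N\<^sup>T *\<^sub>v (b - N *\<^sub>v x) = 0\<^sub>v n"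
    using Suc.IH[OF N b] by blast
  obtain y where y: "y \<in> carrier_vec n" "N\<^sup>T *\<^sub>v (c - N *\<^sub>v y) = 0\<^sub>v n"
    using Suc.IH[OF N c] by blast
  define b' where "b' = b - N *\<^sub>v x"
  define c' where "c' = c - N *\<^sub>v y"
  have b': "b' \<in> carrier_vec m" and c': "c' \<in> carrier_vec m"
    using N b c x y by (auto simp: b'_def c'_def)
  \<comment> \<open>If \<open>c' = 0\<close>, division by zero sets \<open>t = 0\<close>: then \<open>c\<close> lies in the range of \<open>N\<close>, and \<open>b'\<close> is
    already orthogonal to it.\<close>
  define t where "t = (c' \<bullet> b') / (c' \<bullet> c')"
  define r where "r = b' - t \<cdot>\<^sub>v c'"
  have r: "r \<in> carrier_vec m" using b' c' by (simp add: r_def)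
  define z where "z = x - t \<cdot>\<^sub>v y"
  have z: "z \<in> carrier_vec n" using x y by (simp add: z_def)
  define w where "w = vec (Suc n) (\<lambda>i. if i < n then z $ i else t)"
  have Nt: "N\<^sup>T \<in> carrier_mat n m" using N by simp
  have "N\<^sup>T *\<^sub>v r = N\<^sup>T *\<^sub>v b' - t \<cdot>\<^sub>v (N\<^sup>T *\<^sub>v c')"
    using mult_minus_distrib_mat_vec[OF Nt b' smult_carrier_vec[THEN iffD2, OF c']]
      mult_mat_vec[OF Nt c'] by (simp only: r_def)
  then have Nr: "N\<^sup>T *\<^sub>v r = 0\<^sub>v n"
    by (simp only: x(2)[folded b'_def] y(2)[folded c'_def]) (auto intro!: eq_vecI)
  have "c' \<bullet> r = 0"
  proof (cases "c' = 0\<^sub>v m")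
    case True
    then show ?thesis using r by simp
  next
    case False
    then have "c' \<bullet> c' \<noteq> 0" using euclid_norm_eq_0[OF c'] euclid_norm_square[of c'] by auto
    then show ?thesis
      using b' c' by (simp add: r_def scalar_prod_minus_distrib[of _ m] t_def)
  qed
  moreover have "(N *\<^sub>v y) \<bullet> r = 0"
    using scalar_prod_transpose[OF N y(1) r] Nr y by simp
  moreover have "c = c' + N *\<^sub>v y" using c N y by (auto simp: c'_def)
  ultimately have cr: "c \<bullet> r = 0"
    using c' r N y by (simp add: add_scalar_prod_distrib[of _ m])
  have "M *\<^sub>v w = N *\<^sub>v z + t \<cdot>\<^sub>v c"
  proof (rule eq_vecI)
    fix i assume "i < dim_vec (N *\<^sub>v z + t \<cdot>\<^sub>v c)"
    then have i: "i < m" using c by simp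
    have "(M *\<^sub>v w) $ i = (\<Sum>j\<in>{0..<Suc n}. M $$ (i, j) * w $ j)"
      using Suc.prems i by (simp add: scalar_prod_def w_def)
    also have "\<dots> = (\<Sum>j\<in>{0..<n}. N $$ (i, j) * z $ j) + c $ i * t"
      using Suc.prems i by (simp add: w_def N_def c_def)
    also have "\<dots> = (N *\<^sub>v z + t \<cdot>\<^sub>v c) $ i"
      using N c z i by (simp add: scalar_prod_def)
    finally show "(M *\<^sub>v w) $ i = (N *\<^sub>v z + t \<cdot>\<^sub>v c) $ i" .
  qed (use Suc.prems N c in simp)
  also have "b - \<dots> = r"
  proof -
    define u where "u = N *\<^sub>v x"
    define v where "v = N *\<^sub>v y"
    have uv: "u \<in> carrier_vec m" "v \<in> carrier_vec m" using N x y by (auto simp: u_def v_def)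
    have "N *\<^sub>v z = u - t \<cdot>\<^sub>v v"
      using mult_minus_distrib_mat_vec[OF N x(1) smult_carrier_vec[THEN iffD2, OF y(1)]]
        mult_mat_vec[OF N y(1)] by (simp only: z_def u_def v_def)
    moreover have "b - (u - t \<cdot>\<^sub>v v + t \<cdot>\<^sub>v c) = (b - u) - t \<cdot>\<^sub>v (c - v)"
      using uv b c by (intro eq_vecI) (auto simp: algebra_simps)
    ultimately show ?thesis by (simp only: r_def b'_def c'_def u_def v_def)
  qed
  finally have res: "b - M *\<^sub>v w = r" .
  have "M\<^sup>T *\<^sub>v r = 0\<^sub>v (Suc n)"
  proof (rule eq_vecI)
    fix j assume "j < dim_vec (0\<^sub>v (Suc n) :: real vec)"
    then consider "j < n" | "j = n" by fastforce
    then show "(M\<^sup>T *\<^sub>v r) $ j = 0\<^sub>v (Suc n) $ j"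
    proof cases
      case 1
      have "col M j = col N j" using 1 Suc.prems by (auto simp: N_def)
      moreover have "(N\<^sup>T *\<^sub>v r) $ j = col N j \<bullet> r" using 1 N by simp
      ultimately show ?thesis using 1 Nr Suc.prems by simp
    next
      case 2
      then show ?thesis using cr Suc.prems by (simp add: c_def)
    qed
  qed (use Suc.prems in simp)
  moreover have "w \<in> carrier_vec (Suc n)" by (simp add: w_def)
  ultimately show ?case using res by blast
qed

lemma normal_equations_solution:
  assumes M: "(M :: real mat) \<in> carrier_mat m n"
  obtains X where "X \<in> carrier_mat n m" "M\<^sup>T * (M * X) = M\<^sup>T"
proof -
  have "\<forall>j. \<exists>x. x \<in> carrier_vec n \<and> M\<^sup>T *\<^sub>v (unit_vec m j - M *\<^sub>v x) = 0\<^sub>v n"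
    using least_squares_solution[OF M unit_vec_carrier] by blast
  from choice[OF this] obtain f
    where f_all: "\<forall>j. f j \<in> carrier_vec n \<and> M\<^sup>T *\<^sub>v (unit_vec m j - M *\<^sub>v f j) = 0\<^sub>v n" ..
  have f: "f j \<in> carrier_vec n" "M\<^sup>T *\<^sub>v (unit_vec m j - M *\<^sub>v f j) = 0\<^sub>v n" for j
    using f_all by auto
  define X where "X = mat_of_cols n (map f [0..<m])"
  have X: "X \<in> carrier_mat n m"
    unfolding X_def using mat_of_cols_carrier(1)[of n "map f [0..<m]"] by simp
  have "M\<^sup>T * (M * X) = M\<^sup>T"
  proof (rule mat_col_eqI)
    fix j assume "j < dim_col (M\<^sup>T)"
    then have j: "j < m" using M by simp
    have "col X j = f j" using j f(1) by (simp add: X_def)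
    then have "col (M\<^sup>T * (M * X)) j = M\<^sup>T *\<^sub>v (M *\<^sub>v f j)"
      using col_mult2[OF _ mult_carrier_mat[OF M X] j, of "M\<^sup>T" n] col_mult2[OF M X j] M
      by (simp only: transpose_carrier_mat)
    also have "\<dots> = M\<^sup>T *\<^sub>v unit_vec m j"
    proof -
      have carr: "M\<^sup>T \<in> carrier_mat n m" "M *\<^sub>v f j \<in> carrier_vec m" using M f(1) by auto
      define u where "u = M\<^sup>T *\<^sub>v unit_vec m j"
      define v where "v = M\<^sup>T *\<^sub>v (M *\<^sub>v f j)"
      have uv: "u \<in> carrier_vec n" "v \<in> carrier_vec n" using carr by (auto simp: u_def v_def)
      have "u - v = 0\<^sub>v n"
        using f(2)[of j] mult_minus_distrib_mat_vec[OF carr(1) unit_vec_carrier carr(2)]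
        by (simp only: u_def v_def)
      then have "(u - v) $ i = 0" if "i < n" for i using that by simp
      then have "v = u" using uv by (intro eq_vecI) auto
      then show ?thesis by (simp only: u_def v_def)
    qed
    also have "\<dots> = col (M\<^sup>T) j"
      using M j by (intro eq_vecI) auto
    finally show "col (M\<^sup>T * (M * X)) j = col (M\<^sup>T) j" .
  qed (use M X in auto)
  with X that show ?thesis by blast
qed

text \<open>Multiplying \<open>M\<^sup>T * (M * X) = M\<^sup>T\<close> by \<open>X\<^sup>T\<close> equates \<open>(M * X)\<^sup>T\<close> with the symmetric matrix
  \<open>(M * X)\<^sup>T * (M * X)\<close>; after that, transposing the equation gives \<open>M * X * M = M\<close>.\<close>

lemma orthogonal_projection_onto_range:
  assumes M: "(M :: real mat) \<in> carrier_mat m n"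
  obtains X where "X \<in> carrier_mat n m" "(M * X)\<^sup>T = M * X" "M * X * M = M"
proof -
  obtain X where X: "X \<in> carrier_mat n m" and eq: "M\<^sup>T * (M * X) = M\<^sup>T"
    by (rule normal_equations_solution[OF M])
  have MX: "M * X \<in> carrier_mat m m" using M X by simp
  have "(M * X)\<^sup>T * (M * X) = X\<^sup>T * (M\<^sup>T * (M * X))"
    using M X by (simp add: transpose_mult[OF M X] assoc_mult_mat[of _ m n _ m _ m])
  also have "\<dots> = (M * X)\<^sup>T" by (simp add: eq transpose_mult[OF M X])
  finally have gram: "(M * X)\<^sup>T * (M * X) = (M * X)\<^sup>T" .
  have sym: "(M * X)\<^sup>T = M * X"
    using arg_cong[OF gram, of transpose_mat] transpose_mult[of "(M * X)\<^sup>T" m m "M * X" m] MX gram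
    by simp
  have "M * X * M = (M\<^sup>T * (M * X))\<^sup>T"
    using transpose_mult[of "M\<^sup>T" n m "M * X" m] M MX sym by simp
  also have "\<dots> = M" using eq by simp
  finally show ?thesis using that X sym by blast
qed

text \<open>If \<open>M * X\<close> is the orthogonal projection onto the column space and \<open>Y * M\<close> the one onto the
  row space, then \<open>Y * M * X\<close> has both properties at once, and the outer factors \<open>Y\<close> and \<open>X\<close>
  restrict it as the remaining equation demands. The factor \<open>Y\<close> comes from the transpose of \<open>M\<close>.\<close>

lemma pseudoinverse_exists:
  assumes M: "M \<in> carrier_mat m n"
  shows "\<exists>X. is_pseudoinverse M X"
proof -
  obtain X where X: "X \<in> carrier_mat n m" "(M * X)\<^sup>T = M * X" "M * X * M = M"
    by (rule orthogonal_projection_onto_range[OF M])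
  have Mt: "M\<^sup>T \<in> carrier_mat n m" using M by simp
  obtain Z where Z: "Z \<in> carrier_mat m n" "(M\<^sup>T * Z)\<^sup>T = M\<^sup>T * Z" "M\<^sup>T * Z * M\<^sup>T = M\<^sup>T"
    by (rule orthogonal_projection_onto_range[OF Mt])
  define Y where "Y = Z\<^sup>T"
  have Y: "Y \<in> carrier_mat n m" using Z by (simp add: Y_def)
  have YMt: "Y * M = M\<^sup>T * Z"
    using Z(2) transpose_mult[OF Mt Z(1)] by (simp add: Y_def)
  have YM: "(Y * M)\<^sup>T = Y * M" using Z(2) by (simp add: YMt)
  have MYM: "M * (Y * M) = M"
    using arg_cong[OF Z(3), of transpose_mat] transpose_mult[of "M\<^sup>T * Z" n n "M\<^sup>T" m] Mt Z
    by (simp add: YMt)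
  have MXM: "M * (X * M) = M"
    using X(3) assoc_mult_mat[OF M X(1) M] by simp
  have cX: "X \<in> carrier_mat n m" and cYM: "Y * M \<in> carrier_mat n n"
    and cYMX: "Y * M * X \<in> carrier_mat n m"
    using M X(1) Y by auto
  have left: "M * (Y * M * X) = M * X"
    by (simp only: assoc_mult_mat[OF M cYM cX, symmetric] MYM)
  have right: "Y * M * X * M = Y * M"
    by (simp only: assoc_mult_mat[OF cYM cX M] assoc_mult_mat[OF Y M mult_carrier_mat[OF cX M]] MXM)
  have "Y * M * X * M * (Y * M * X) = Y * (M * X)"
    by (simp only: right assoc_mult_mat[OF Y M cYMX] left)
  also have "\<dots> = Y * M * X" by (simp only: assoc_mult_mat[OF Y M cX])
  finally have outer: "Y * M * X * M * (Y * M * X) = Y * M * X" .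
  have "is_pseudoinverse M (Y * M * X)"
    unfolding is_pseudoinverse_def carrier_matD[OF M]
    by (intro conjI cYMX outer) (simp_all only: left right X(2,3) YM)
  then show ?thesis ..
qed

text \<open>For any two candidates, \<open>M * X\<close> and \<open>M * Y\<close> are orthogonal projections onto the same
  subspace and so agree, and likewise \<open>X * M\<close> and \<open>Y * M\<close>; a candidate is recovered from these
  two products as \<open>X = X * M * X\<close>.\<close>

lemma pseudoinverse_unique:
  assumes X: "is_pseudoinverse M X" and Y: "is_pseudoinverse M Y"
  shows "X = Y"
proof -
  define m n where "m = dim_row M" and "n = dim_col M"
  have M: "M \<in> carrier_mat m n" by (simp add: m_def n_def)
  have cX: "X \<in> carrier_mat n m" and cY: "Y \<in> carrier_mat n m"
    using X Y by (auto simp: is_pseudoinverse_def m_def n_def)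
  have cMX: "M * X \<in> carrier_mat m m" and cMY: "M * Y \<in> carrier_mat m m"
    and cXM: "X * M \<in> carrier_mat n n" and cYM: "Y * M \<in> carrier_mat n n"
    using M cX cY by auto
  have x: "M * X * M = M" "X * M * X = X" "(M * X)\<^sup>T = M * X" "(X * M)\<^sup>T = X * M"
    and y: "M * Y * M = M" "Y * M * Y = Y" "(M * Y)\<^sup>T = M * Y" "(Y * M)\<^sup>T = Y * M"
    using X Y by (auto simp only: is_pseudoinverse_def)
  have YX: "M * Y * (M * X) = M * X" by (simp only: assoc_mult_mat[OF cMY M cX, symmetric] y(1))
  have XY: "M * X * (M * Y) = M * Y" by (simp only: assoc_mult_mat[OF cMX M cY, symmetric] x(1))
  have "M * X = (M * Y * (M * X))\<^sup>T" by (simp only: YX x(3))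
  also have "\<dots> = M * Y" by (simp only: transpose_mult[OF cMY cMX] x(3) y(3) XY)
  finally have range: "M * X = M * Y" .
  have YX': "Y * M * (X * M) = Y * M"
    by (simp only: assoc_mult_mat[OF cY M cXM] assoc_mult_mat[OF M cX M, symmetric] x(1))
  have XY': "X * M * (Y * M) = X * M"
    by (simp only: assoc_mult_mat[OF cX M cYM] assoc_mult_mat[OF M cY M, symmetric] y(1))
  have "X * M = (X * M * (Y * M))\<^sup>T" by (simp only: XY' x(4))
  also have "\<dots> = Y * M" by (simp only: transpose_mult[OF cXM cYM] x(4) y(4) YX')
  finally have corange: "X * M = Y * M" .
  have "X = Y * M * X" by (simp only: corange[symmetric] x(2))
  also have "\<dots> = Y * (M * Y)" by (simp only: assoc_mult_mat[OF cY M cX] range)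
  also have "\<dots> = Y" by (simp only: assoc_mult_mat[OF cY M cY, symmetric] y(2))
  finally show ?thesis .
qed

lemma is_pseudoinverse_pseudoinverse: "is_pseudoinverse M (pseudoinverse M)"
proof -
  obtain X where X: "is_pseudoinverse M X"
    using pseudoinverse_exists[of M "dim_row M" "dim_col M"] by auto
  show ?thesis
    unfolding pseudoinverse_def using X pseudoinverse_unique[OF _ X] by (rule theI)
qed

section \<open>Selection matrices\<close>

lemma selection_mat_carrier: "selection_mat n q \<in> carrier_mat n (length q)"
  unfolding selection_mat_def
  using mat_of_cols_carrier(1)[of n "map (col (1\<^sub>m n)) q"] by simp

lemma col_selection_mat:
  assumes "set q \<subseteq> {..<n}" "j < length q"
  shows "col (selection_mat n q) j = unit_vec n (q ! j)"
  using assms by (auto simp: selection_mat_def subset_iff)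

text \<open>A left inverse separates the columns, while a repeated index repeats a column.\<close>

lemma left_inverse_selection_mat_distinct:
  assumes q: "set q \<subseteq> {..<n}" and L: "L \<in> carrier_mat (length q) n"
    and LQ: "L * selection_mat n q = 1\<^sub>m (length q)"
  shows "distinct q"
  unfolding distinct_conv_nth
proof (intro allI impI notI)
  fix i j assume ij: "i < length q" "j < length q" "i \<noteq> j" "q ! i = q ! j"
  have "unit_vec (length q) l = L *\<^sub>v unit_vec n (q ! l)" if "l < length q" for l
    using col_mult2[OF L selection_mat_carrier that] LQ that
    by (simp add: col_selection_mat[OF q])
  with ij have "unit_vec (length q) i = (unit_vec (length q) j :: real vec)" by metis
  then show False using ij by (metis index_unit_vec(1) zero_neq_one)
qed

lemma selection_mat_orthonormal:
  assumes q: "set q \<subseteq> {..<n}" and d: "distinct q"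
  shows "(selection_mat n q)\<^sup>T * selection_mat n q = 1\<^sub>m (length q)"
proof (rule eq_matI)
  fix i j assume ij: "i < dim_row (1\<^sub>m (length q) :: real mat)" "j < dim_col (1\<^sub>m (length q) :: real mat)"
  have "q ! j < n" "q ! i < n" using q ij by (auto simp: subset_iff)
  then show "((selection_mat n q)\<^sup>T * selection_mat n q) $$ (i, j) = 1\<^sub>m (length q) $$ (i, j)"
    using ij d selection_mat_carrier[of n q]
    by (simp add: col_selection_mat[OF q] nth_eq_iff_index_eq)
qed (use selection_mat_carrier[of n q] in auto)

lemma DEIM_indices:
  assumes "DEIM V p"
  shows "length p = dim_col V" "set p \<subseteq> {..<dim_row V}"
proof -
  show len: "length p = dim_col V" using assms by (simp add: DEIM_def)
  show "set p \<subseteq> {..<dim_row V}"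
  proof
    fix i assume "i \<in> set p"
    then obtain j where j: "j < dim_col V" "i = p ! j" by (auto simp: in_set_conv_nth len)
    then show "i \<in> {..<dim_row V}"
      using assms by (cases "j = 0") (auto simp: DEIM_def Let_def attains_max_abs_at_def)
  qed
qed

section \<open>Inverse matrices\<close>

lemma mat_inv_inverts:
  assumes N: "N \<in> carrier_mat k k" and inv: "invertible_mat N"
  shows "mat_inv N \<in> carrier_mat k k" "N * mat_inv N = 1\<^sub>m k" "mat_inv N * N = 1\<^sub>m k"
proof -
  obtain B where "inverts_mat N B" "inverts_mat B N"
    using inv unfolding invertible_mat_def by blast
  then have B: "N * B = 1\<^sub>m k" "B * N = 1\<^sub>m (dim_row B)"
    by (simp_all only: inverts_mat_def carrier_matD[OF N])
  have "B \<in> carrier_mat k k"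
  proof (rule carrier_matI)
    show "dim_col B = k" using arg_cong[OF B(1), of dim_col] by simp
    show "dim_row B = k" using arg_cong[OF B(2), of dim_col] carrier_matD[OF N] by simp
  qed
  moreover from this B have "B * N = 1\<^sub>m k" by (simp only: carrier_matD)
  ultimately have "N \<in> Units (ring_mat TYPE(real) k ())"
    using B(1) N by (auto simp: Units_def ring_mat_def)
  then obtain B' where "mat_inverse N = Some B'"
    using mat_inverse(1)[OF N, where b = "()"] by (cases "mat_inverse N") auto
  then show "mat_inv N \<in> carrier_mat k k" "N * mat_inv N = 1\<^sub>m k" "mat_inv N * N = 1\<^sub>m k"
    using mat_inverse(2)[OF N] by (auto simp: mat_inv_def)
qed

section \<open>The interpolatory projection bound\<close>

text \<open>The matrix \<open>B * W\<^sup>T\<close> stands for any approximation of \<open>A\<close> whose rows lie in the span of the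
  columns of \<open>W\<close>. Such rows are reproduced by the oblique projection \<open>H = Q * G * W\<^sup>T\<close>, so that
  \<open>1 - H\<close> sees only the approximation error, and the orthogonal projection \<open>A * Q * X\<close> does at
  least as well as \<open>H\<close>, whose image \<open>A * H\<close> lies in the range of \<open>A * Q\<close>.\<close>

lemma column_projection_error:
  assumes A: "A \<in> carrier_mat m n" and B: "B \<in> carrier_mat m k" and W: "W \<in> carrier_mat n k"
    and Q: "Q \<in> carrier_mat n k" and X: "X \<in> carrier_mat k m" and G: "G \<in> carrier_mat k k"
    and k: "1 \<le> k"
    and Qnorm: "spectral_norm Q \<le> 1"
    and WQG: "W\<^sup>T * Q * G = 1\<^sub>m k" and GWQ: "G * (W\<^sup>T * Q) = 1\<^sub>m k"
    and sym: "(A * Q * X)\<^sup>T = A * Q * X" and proj: "A * Q * X * (A * Q) = A * Q"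
  shows "spectral_norm (A - A * Q * X * A)
    \<le> spectral_norm W * spectral_norm G * spectral_norm (A - B * W\<^sup>T)"
proof -
  define E where "E = A - B * W\<^sup>T"
  define L where "L = G * W\<^sup>T"
  define H where "H = Q * L"
  define N where "N = 1\<^sub>m n - H"
  define F where "F = A * Q * X"
  define J where "J = 1\<^sub>m m - F"
  have Wt: "W\<^sup>T \<in> carrier_mat k n" using W by simp
  have E: "E \<in> carrier_mat m n" using A B W unfolding E_def by (intro minus_carrier_mat) simp
  have L: "L \<in> carrier_mat k n" using G W by (simp add: L_def)
  have H: "H \<in> carrier_mat n n" using Q L by (simp add: H_def)
  have N: "N \<in> carrier_mat n n" unfolding N_def by (rule minus_carrier_mat[OF H])
  have F: "F \<in> carrier_mat m m" using A Q X by (simp add: F_def)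
  have J: "J \<in> carrier_mat m m" unfolding J_def by (rule minus_carrier_mat[OF F])
  have AQ: "A * Q \<in> carrier_mat m k" using A Q by simp
  have LQ: "L * Q = 1\<^sub>m k"
    using GWQ assoc_mult_mat[OF G Wt Q] by (simp add: L_def)
  have HQ: "H * Q = Q" using assoc_mult_mat[OF Q L Q] LQ Q by (simp add: H_def)
  have HH: "H * H = H" using assoc_mult_mat[OF H Q L] HQ by (simp add: H_def)
  have WH: "W\<^sup>T * H = W\<^sup>T"
  proof -
    have "W\<^sup>T * H = W\<^sup>T * Q * L" using assoc_mult_mat[OF Wt Q L] by (simp add: H_def)
    also have "\<dots> = W\<^sup>T * Q * G * W\<^sup>T"
      using assoc_mult_mat[of "W\<^sup>T * Q" k k G k "W\<^sup>T" n] Wt Q G by (simp add: L_def)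
    finally show ?thesis using WQG Wt by simp
  qed
  \<comment> \<open>Here \<open>1 \<le> k\<close> enters: for \<open>k = 0\<close> the projection would be \<open>0\<close> and its complement \<open>1\<close>.\<close>
  have H0: "H \<noteq> 0\<^sub>m n n"
  proof
    assume "H = 0\<^sub>m n n"
    then have "Q = 0\<^sub>m n k" using HQ Q by simp
    then have "(1\<^sub>m k :: real mat) = 0\<^sub>m k k" using LQ L by simp
    then have "(1\<^sub>m k :: real mat) $$ (0, 0) = 0\<^sub>m k k $$ (0, 0)" by simp
    then show False using k by simp
  qed
  have EN: "E * N = A * N"
  proof -
    have "W\<^sup>T * N = 0\<^sub>m k n"
      using Wt H WH by (simp add: N_def mult_minus_distrib_mat[OF Wt _ H])
    then have "B * W\<^sup>T * N = 0\<^sub>m m n"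
      using assoc_mult_mat[OF B Wt N] B by simp
    moreover have "A * N - 0\<^sub>m m n = A * N" using A N by auto
    ultimately show ?thesis
      unfolding E_def using A B Wt N by (subst minus_mult_distrib_mat[of _ m n]) auto
  qed
  have "1\<^sub>m m * (A * Q) - F * (A * Q) = 0\<^sub>m m k"
    using left_mult_one_mat[OF AQ] minus_r_inv_mat[OF AQ] proj by (simp only: F_def)
  then have JAQ: "J * (A * Q) = 0\<^sub>m m k"
    using minus_mult_distrib_mat[OF one_carrier_mat F AQ] by (simp only: J_def)
  have JA: "J * A = A - F * A"
    using A F by (simp add: J_def minus_mult_distrib_mat[of _ m m])
  have "J * (A * N) = J * A"
  proof -
    have "J * (A * H) = J * (A * Q) * L"
      using assoc_mult_mat[OF A Q L] assoc_mult_mat[OF J AQ L] by (simp add: H_def)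
    also have "\<dots> = 0\<^sub>m m n" using JAQ L by simp
    finally have "J * (A * H) = 0\<^sub>m m n" .
    moreover have "A * N = A - A * H"
      using A H by (simp add: N_def mult_minus_distrib_mat[OF A _ H])
    moreover have "J * (A - A * H) = J * A - J * (A * H)"
      using A H by (intro mult_minus_distrib_mat[OF J]) auto
    moreover have "J * A - 0\<^sub>m m n = J * A" using J A by auto
    ultimately show ?thesis by simp
  qed
  then have eq: "A - F * A = J * (E * N)" by (simp add: EN JA)
  have FF: "F * F = F"
    using assoc_mult_mat[OF F AQ X] proj by (simp add: F_def)
  have JJ: "J * J = J" unfolding J_def by (rule complement_projection[OF F FF])
  have "J\<^sup>T = 1\<^sub>m m - F\<^sup>T" using F unfolding J_def by (subst transpose_minus[of _ m m]) auto
  then have Jn: "spectral_norm J \<le> 1"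
    using sym by (intro spectral_norm_orthogonal_projection_le[OF J _ JJ]) (simp add: J_def F_def)
  have "spectral_norm N \<le> spectral_norm H"
    unfolding N_def by (rule spectral_norm_complement_projection_le[OF H HH H0])
  also have "\<dots> \<le> spectral_norm Q * spectral_norm L"
    unfolding H_def by (rule spectral_norm_mult_le[OF Q L])
  also have "\<dots> \<le> 1 * spectral_norm L"
    by (intro mult_right_mono Qnorm spectral_norm_ge_0)
  also have "spectral_norm L \<le> spectral_norm G * spectral_norm W"
    using spectral_norm_mult_le[OF G Wt] by (simp add: L_def spectral_norm_transpose)
  finally have Nn: "spectral_norm N \<le> spectral_norm G * spectral_norm W" by simp
  have "spectral_norm (A - F * A) \<le> spectral_norm J * spectral_norm (E * N)"
    unfolding eq by (rule spectral_norm_mult_le[OF J mult_carrier_mat[OF E N]])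
  also have "\<dots> \<le> 1 * spectral_norm (E * N)"
    by (intro mult_right_mono Jn spectral_norm_ge_0)
  also have "spectral_norm (E * N) \<le> spectral_norm E * spectral_norm N"
    by (rule spectral_norm_mult_le[OF E N])
  also have "\<dots> \<le> spectral_norm E * (spectral_norm G * spectral_norm W)"
    by (intro mult_left_mono Nn spectral_norm_ge_0)
  finally show ?thesis by (simp add: F_def E_def mult_ac)
qed

lemma selected_column_projection_error:
  assumes A: "A \<in> carrier_mat m n" and B: "B \<in> carrier_mat m k" and W: "W \<in> carrier_mat n k"
    and X: "X \<in> carrier_mat k m" and k: "1 \<le> k"
    and q: "length q = k" "set q \<subseteq> {..<n}" and Q: "Q = selection_mat n q"
    and G: "G \<in> carrier_mat k k"
    and WQG: "W\<^sup>T * Q * G = 1\<^sub>m k" and GWQ: "G * (W\<^sup>T * Q) = 1\<^sub>m k"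
    and sym: "(A * Q * X)\<^sup>T = A * Q * X" and proj: "A * Q * X * (A * Q) = A * Q"
  shows "spectral_norm (A - A * Q * X * A)
    \<le> spectral_norm W * spectral_norm G * spectral_norm (A - B * W\<^sup>T)"
proof -
  have cQ: "Q \<in> carrier_mat n k" using selection_mat_carrier[of n q] q Q by simp
  have "G * W\<^sup>T * Q = 1\<^sub>m k" using GWQ G W cQ by simp
  then have "distinct q"
    using G W q Q by (intro left_inverse_selection_mat_distinct[of q n "G * W\<^sup>T"]) auto
  then have "spectral_norm Q \<le> 1"
    using selection_mat_orthonormal[OF q(2)] q(1) Q
    by (intro spectral_norm_orthonormal_columns_le[OF cQ]) simp
  then show ?thesis
    using column_projection_error[OF A B W cQ X G k _ WQG GWQ sym proj] by blast
qed

section \<open>The CUR error bound\<close>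

theorem theorem3p3:
  fixes A V S W P Q C R U :: "real mat"
    and m n k :: nat
    and \<theta> \<phi> \<eta>p \<eta>q :: real
    and p q :: "nat list"
  assumes "A \<in> carrier_mat m n"
    and "1 \<le> k" and "k < min m n"
    and "V \<in> carrier_mat m k"
    and "S \<in> carrier_mat k k"
    and "W \<in> carrier_mat n k"
    and "spectral_norm (A - V * S * W\<^sup>T) \<le> \<theta> * (singular_values A ! k) + \<phi>"
    and "DEIM V p"
    and "DEIM W q"
    and "P = selection_mat m p"
    and "Q = selection_mat n q"
    and "invertible_mat (P\<^sup>T * V)"
    and "invertible_mat (W\<^sup>T * Q)"
    and "\<eta>p = spectral_norm (mat_inv (P\<^sup>T * V))"
    and "\<eta>q = spectral_norm (mat_inv (W\<^sup>T * Q))"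
    and "C = A * Q"
    and "R = P\<^sup>T * A"
    and "U = pseudoinverse C * A * pseudoinverse R"
  shows "spectral_norm (A - C * U * R)
       \<le> (spectral_norm W * \<eta>q + spectral_norm V * \<eta>p) * (\<theta> * (singular_values A ! k) + \<phi>)"
proof -
  note A = assms(1) and k = assms(2) and V = assms(4) and S = assms(5) and W = assms(6)
  define E where "E = A - V * S * W\<^sup>T"
  define X where "X = pseudoinverse C"
  define Y where "Y = pseudoinverse R"
  have p: "length p = k" "set p \<subseteq> {..<m}" using DEIM_indices[OF assms(8)] V by auto
  have q: "length q = k" "set q \<subseteq> {..<n}" using DEIM_indices[OF assms(9)] W by auto
  have P: "P \<in> carrier_mat m k" using selection_mat_carrier[of m p] assms(10) p by simp
  have Q: "Q \<in> carrier_mat n k" using selection_mat_carrier[of n q] assms(11) q by simp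
  have C: "C \<in> carrier_mat m k" using A Q assms(16) by simp
  have R: "R \<in> carrier_mat k n" using A P assms(17) by simp
  have X: "X \<in> carrier_mat k m" "C * X * C = C" "(C * X)\<^sup>T = C * X"
    using is_pseudoinverse_pseudoinverse[of C] C by (auto simp: X_def is_pseudoinverse_def)
  have Y: "Y \<in> carrier_mat n k" "R * Y * R = R" "(Y * R)\<^sup>T = Y * R"
    using is_pseudoinverse_pseudoinverse[of R] R by (auto simp: Y_def is_pseudoinverse_def)
  have CX: "C * X \<in> carrier_mat m m" using C X by simp
  have YR: "Y * R \<in> carrier_mat n n" using Y R by simp
  have "C * X * (C * X) = C * X"
    using assoc_mult_mat[OF CX C X(1)] X by simp
  then have CXn: "spectral_norm (C * X) \<le> 1"
    by (intro spectral_norm_orthogonal_projection_le[OF CX X(3)])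

  have col_err: "spectral_norm (A - C * X * A) \<le> spectral_norm W * \<eta>q * spectral_norm E"
  proof -
    have "W\<^sup>T * Q \<in> carrier_mat k k" using W Q by simp
    note inv = mat_inv_inverts[OF this assms(13)]
    have VS: "V * S \<in> carrier_mat m k" using V S by simp
    show ?thesis
      using selected_column_projection_error[OF A VS W X(1) k q assms(11) inv] X
      by (simp add: assms(15,16) E_def)
  qed

  \<comment> \<open>The row half is the column half for the transposed data.\<close>
  have row_err: "spectral_norm (A - A * (Y * R)) \<le> spectral_norm V * \<eta>p * spectral_norm E"
  proof -
    define G where "G = mat_inv (P\<^sup>T * V)"
    have PV: "P\<^sup>T * V \<in> carrier_mat k k" using P V by simp
    note inv = mat_inv_inverts[OF this assms(12), folded G_def]
    have At: "A\<^sup>T \<in> carrier_mat n m" using A by simp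
    have WS: "W * S\<^sup>T \<in> carrier_mat n k" using W S by simp
    have Yt: "Y\<^sup>T \<in> carrier_mat k n" using Y by simp
    have Gt: "G\<^sup>T \<in> carrier_mat k k" using inv by simp
    have VP: "V\<^sup>T * P = (P\<^sup>T * V)\<^sup>T" using transpose_mult[of "P\<^sup>T" k m V k] P V by simp
    have VPG: "V\<^sup>T * P * G\<^sup>T = 1\<^sub>m k"
      using transpose_mult[OF inv(1) PV] inv(3) by (simp add: VP)
    have GVP: "G\<^sup>T * (V\<^sup>T * P) = 1\<^sub>m k"
      using transpose_mult[OF PV inv(1)] inv(2) by (simp add: VP)
    have AP: "A\<^sup>T * P = R\<^sup>T"
      using transpose_mult[of "P\<^sup>T" k m A n] P A assms(17) by simp
    have APY: "A\<^sup>T * P * Y\<^sup>T = Y * R"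
      using transpose_mult[OF Y(1) R] Y(3) by (simp add: AP)
    have proj: "Y * R * R\<^sup>T = R\<^sup>T"
    proof -
      have "R * (Y * R) = R" using Y(2) assoc_mult_mat[OF R Y(1) R] by simp
      then show ?thesis using transpose_mult[OF R YR] Y(3) by simp
    qed
    have symT: "(A\<^sup>T * P * Y\<^sup>T)\<^sup>T = A\<^sup>T * P * Y\<^sup>T"
      by (simp only: APY Y(3))
    have projT: "A\<^sup>T * P * Y\<^sup>T * (A\<^sup>T * P) = A\<^sup>T * P"
      by (simp only: APY) (simp only: AP proj)
    have "spectral_norm (A\<^sup>T - A\<^sup>T * P * Y\<^sup>T * A\<^sup>T)
        \<le> spectral_norm V * spectral_norm (G\<^sup>T) * spectral_norm (A\<^sup>T - W * S\<^sup>T * V\<^sup>T)"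
      by (rule selected_column_projection_error[OF At WS V Yt k p assms(10) Gt VPG GVP
          symT projT])
    moreover have "A\<^sup>T - A\<^sup>T * P * Y\<^sup>T * A\<^sup>T = (A - A * (Y * R))\<^sup>T"
    proof -
      have "(A - A * (Y * R))\<^sup>T = A\<^sup>T - (A * (Y * R))\<^sup>T"
        using A YR by (intro transpose_minus) auto
      then show ?thesis using transpose_mult[OF A YR] Y(3) by (simp add: APY)
    qed
    moreover have "A\<^sup>T - W * S\<^sup>T * V\<^sup>T = E\<^sup>T"
    proof -
      have "E\<^sup>T = A\<^sup>T - (V * S * W\<^sup>T)\<^sup>T"
        unfolding E_def using A V S W by (intro transpose_minus) auto
      moreover have "(V * S * W\<^sup>T)\<^sup>T = W * (V * S)\<^sup>T"
        using transpose_mult[of "V * S" m k "W\<^sup>T" n] V S W by simp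
      moreover have "(V * S)\<^sup>T = S\<^sup>T * V\<^sup>T" by (rule transpose_mult[OF V S])
      ultimately show ?thesis using W S V by simp
    qed
    ultimately show ?thesis
      by (simp add: spectral_norm_transpose assms(14) G_def)
  qed

  have CUR: "C * U * R = C * X * (A * (Y * R))"
    using assoc_mult_mat[OF X(1) A Y(1)] assoc_mult_mat[OF C X(1) mult_carrier_mat[OF A Y(1)]]
      assoc_mult_mat[OF CX mult_carrier_mat[OF A Y(1)] R] assoc_mult_mat[OF A Y(1) R]
    by (simp only: assms(18) X_def[symmetric] Y_def[symmetric])
  have split: "A - C * U * R = (A - C * X * A) + C * X * (A - A * (Y * R))"
  proof -
    have "C * X * (A - A * (Y * R)) = C * X * A - C * U * R"
      unfolding CUR using A YR by (intro mult_minus_distrib_mat[OF CX]) auto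
    moreover have "A - C * U * R = (A - C * X * A) + (C * X * A - C * U * R)"
      using A CX YR unfolding CUR by (intro eq_matI) auto
    ultimately show ?thesis by simp
  qed
  let ?D = "A - A * (Y * R)"
  have D: "?D \<in> carrier_mat m n" using A YR by (intro minus_carrier_mat) simp
  have "spectral_norm (A - C * U * R)
      \<le> spectral_norm (A - C * X * A) + spectral_norm (C * X * ?D)"
    unfolding split using A CX D by (intro spectral_norm_triangle[of _ m n] minus_carrier_mat) auto
  also have "spectral_norm (C * X * ?D) \<le> spectral_norm (C * X) * spectral_norm ?D"
    by (rule spectral_norm_mult_le[OF CX D])
  also have "\<dots> \<le> 1 * spectral_norm ?D"
    by (intro mult_right_mono CXn spectral_norm_ge_0)
  finally have "spectral_norm (A - C * U * R)
      \<le> (spectral_norm W * \<eta>q + spectral_norm V * \<eta>p) * spectral_norm E"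
    using col_err row_err by (simp add: distrib_right)
  also have "\<dots> \<le> (spectral_norm W * \<eta>q + spectral_norm V * \<eta>p)
      * (\<theta> * (singular_values A ! k) + \<phi>)"
    using assms(7) by (intro mult_left_mono)
      (simp_all add: E_def assms(14,15) spectral_norm_ge_0)
  finally show ?thesis .
qed

end
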